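(* Let $\alpha$ be an ordinal, let $\mathcal{F}$ be an ultrafilter on a set $I$, and for each $i\in I$ let $\mathfrak{A}_i$ be a substitution algebra of dimension $\alpha$ in which elements are strongly distinguished. Then elements are strongly distinguished in the ultraproduct $\prod\langle\mathfrak{A}_i:i\in I\rangle/\mathcal{F}$.
   Context: A substitution algebra of dimension $\alpha$ ($SA_\alpha$) is an algebra $\langle A,*_\kappa,v_\kappa\rangle_{\kappa<\alpha}$ satisfying, for all $\kappa,\lambda<\alpha$: (1) $x*_\kappa v_\kappa=x$; (2) $x*_\kappa v_\lambda=v_\lambda$ for $\kappa\neq\lambda$; (3) $v_\kappa*_\kappa x=x$; (4) if $w*_\lambda x=x$ for all $w$, then $x*_\lambda(v_\lambda*_\kappa z)=x*_\lambda(x*_\kappa z)$; (5) $(x*_\kappa y)*_\kappa z=x*_\kappa(y*_\kappa z)$; (6) if $w*_\lambda x=x$ for all $w$, then $x*_\kappa(y*_\lambda z)=(x*_\kappa y)*_\lambda(x*_\kappa z)$ for $\kappa\neq\lambda$. For $x\in A$, $\Delta x=\{\kappa<\alpha: a*_\kappa x\neq x\text{ for some }a\in A\}$, $Z=\{x\in A:\Delta x=\emptyset\}$. For $s\in A^\alpha$, $a\in A$, finite $\Sigma=\{\kappa_0<\dots<\kappa_{n-1}\}\subseteq\alpha$: $s*_{(\Sigma)}a=s_{\kappa_{n-1}}*_{\kappa_{n-1}}(\cdots(s_{\kappa_0}*_{\kappa_0}a)\cdots)$, with $s*_{(\emptyset)}a=a$. Elements are strongly distinguished in the algebra if for all $a,b\in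 A$: whenever for every $s\in Z^\alpha$ there is a finite $\Sigma\subseteq\alpha$ with $s*_{(\Sigma)}a=s*_{(\Sigma)}b$, then $a=b$. *)

theory Defs
  imports "HOL-Algebra.Congruence" "HOL-Library.FuncSet"
begin

text \<open>
  An ordinal \<open>\<alpha>\<close> is given by a well-order relation in the sense of \<^const>\<open>Well_order\<close>:
  the ordinals \<open>\<kappa> < \<alpha>\<close> are the elements of \<^term>\<open>Field \<alpha>\<close>, ordered by \<open>\<alpha>\<close> (reflexively).
  In this way \<open>\<alpha>\<close> may be zero, and may be of any size.
\<close>

record ('a, 'k) subst_alg = "'a partial_object" +
  sub :: "'k \<Rightarrow> 'a \<Rightarrow> 'a \<Rightarrow> 'a"
  var :: "'k \<Rightarrow> 'a"

locale substitution_algebra =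
  fixes \<alpha> :: "'k rel" and \<AA> :: "('a, 'k, 'm) subst_alg_scheme"
  assumes sub_closed:
      "\<lbrakk>\<kappa> \<in> Field \<alpha>; x \<in> carrier \<AA>; y \<in> carrier \<AA>\<rbrakk> \<Longrightarrow> sub \<AA> \<kappa> x y \<in> carrier \<AA>"
    and var_closed:
      "\<kappa> \<in> Field \<alpha> \<Longrightarrow> var \<AA> \<kappa> \<in> carrier \<AA>"
    and sub_var_same:
      "\<lbrakk>\<kappa> \<in> Field \<alpha>; x \<in> carrier \<AA>\<rbrakk> \<Longrightarrow> sub \<AA> \<kappa> x (var \<AA> \<kappa>) = x"
    and sub_var_other:
      "\<lbrakk>\<kappa> \<in> Field \<alpha>; \<mu> \<in> Field \<alpha>; \<kappa> \<noteq> \<mu>; x \<in> carrier \<AA>\<rbrakk>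
        \<Longrightarrow> sub \<AA> \<kappa> x (var \<AA> \<mu>) = var \<AA> \<mu>"
    and var_sub:
      "\<lbrakk>\<kappa> \<in> Field \<alpha>; x \<in> carrier \<AA>\<rbrakk> \<Longrightarrow> sub \<AA> \<kappa> (var \<AA> \<kappa>) x = x"
    and sub_rename:
      "\<lbrakk>\<kappa> \<in> Field \<alpha>; \<mu> \<in> Field \<alpha>; x \<in> carrier \<AA>; z \<in> carrier \<AA>;
        \<forall>w\<in>carrier \<AA>. sub \<AA> \<mu> w x = x\<rbrakk>
        \<Longrightarrow> sub \<AA> \<mu> x (sub \<AA> \<kappa> (var \<AA> \<mu>) z) = sub \<AA> \<mu> x (sub \<AA> \<kappa> x z)"
    and sub_assoc:
      "\<lbrakk>\<kappa> \<in> Field \<alpha>; x \<in> carrier \<AA>; y \<in> carrier \<AA>; z \<in> carrier \<AA>\<rbrakk>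
        \<Longrightarrow> sub \<AA> \<kappa> (sub \<AA> \<kappa> x y) z = sub \<AA> \<kappa> x (sub \<AA> \<kappa> y z)"
    and sub_distrib:
      "\<lbrakk>\<kappa> \<in> Field \<alpha>; \<mu> \<in> Field \<alpha>; \<kappa> \<noteq> \<mu>;
        x \<in> carrier \<AA>; y \<in> carrier \<AA>; z \<in> carrier \<AA>;
        \<forall>w\<in>carrier \<AA>. sub \<AA> \<mu> w x = x\<rbrakk>
        \<Longrightarrow> sub \<AA> \<kappa> x (sub \<AA> \<mu> y z) = sub \<AA> \<mu> (sub \<AA> \<kappa> x y) (sub \<AA> \<kappa> x z)"

definition dim_set :: "'k rel \<Rightarrow> ('a, 'k, 'm) subst_alg_scheme \<Rightarrow> 'a \<Rightarrow> 'k set" where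
  "dim_set \<alpha> \<AA> x = {\<kappa> \<in> Field \<alpha>. \<exists>a\<in>carrier \<AA>. sub \<AA> \<kappa> a x \<noteq> x}"

definition zero_dim :: "'k rel \<Rightarrow> ('a, 'k, 'm) subst_alg_scheme \<Rightarrow> 'a set" where
  "zero_dim \<alpha> \<AA> = {x \<in> carrier \<AA>. dim_set \<alpha> \<AA> x = {}}"

text \<open>
  \<open>increasing_enum \<alpha> \<Sigma>\<close> is the list of the elements of a finite
  set \<open>\<Sigma>\<close>, strictly increasing with respect to \<open>\<alpha>\<close>. It exists uniquely for finite \<open>\<Sigma> \<subseteq> Field \<alpha>\<close>.
\<close>

definition increasing_enum :: "'k rel \<Rightarrow> 'k set \<Rightarrow> 'k list" where
  "increasing_enum \<alpha> \<Sigma> =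
    (THE ks. set ks = \<Sigma> \<and> sorted_wrt (\<lambda>\<kappa> \<mu>. \<kappa> \<noteq> \<mu> \<and> (\<kappa>, \<mu>) \<in> \<alpha>) ks)"

lemma increasing_enum_ex1:
  assumes "Well_order \<alpha>" and "finite \<Sigma>" and "\<Sigma> \<subseteq> Field \<alpha>"
  shows "\<exists>!ks. set ks = \<Sigma> \<and> sorted_wrt (\<lambda>\<kappa> \<mu>. \<kappa> \<noteq> \<mu> \<and> (\<kappa>, \<mu>) \<in> \<alpha>) ks"
proof -
  let ?R = "\<lambda>\<kappa> \<mu>. \<kappa> \<noteq> \<mu> \<and> (\<kappa>, \<mu>) \<in> \<alpha>"
  have tr: "trans \<alpha>" and anti: "antisym \<alpha>" and tot: "total_on (Field \<alpha>) \<alpha>"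
    using assms(1) by (auto simp: order_on_defs)
  have R_trans: "?R x z" if "?R x y" "?R y z" for x y z
    using that tr anti by (meson antisymD transD)
  have ex: "\<exists>ks. set ks = \<Sigma> \<and> sorted_wrt ?R ks"
    using assms(2,3)
  proof (induction \<Sigma> rule: finite_induct)
    case empty
    show ?case by (intro exI[of _ "[]"]) simp
  next
    case (insert x \<Sigma>)
    then obtain ks where ks: "set ks = \<Sigma>" "sorted_wrt ?R ks" by auto
    let ?l = "filter (\<lambda>k. ?R k x) ks" and ?r = "filter (\<lambda>k. ?R x k) ks"
    have "set ?l \<union> set ?r = \<Sigma>"
      using insert.hyps insert.prems ks(1) tot by (auto simp: total_on_def)
    moreover have "sorted_wrt ?R (?l @ x # ?r)"
      unfolding sorted_wrt_append sorted_wrt.simps set_filter list.set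
      using sorted_wrt_filter[OF ks(2)] R_trans by blast
    ultimately show ?case by (intro exI[of _ "?l @ x # ?r"]) auto
  qed
  have uniq: "ks = ls" if "sorted_wrt ?R ks" "sorted_wrt ?R ls" "set ks = set ls" for ks ls
    using that
  proof (induction ks arbitrary: ls)
    case Nil
    then show ?case by simp
  next
    case (Cons k ks)
    then obtain l ls' where ls: "ls = l # ls'" by (cases ls) auto
    have "k = l"
    proof (rule ccontr)
      assume "k \<noteq> l"
      then have "l \<in> set ks" "k \<in> set ls'" using Cons.prems(3) ls by auto
      then have "(k, l) \<in> \<alpha>" "(l, k) \<in> \<alpha>" using Cons.prems ls by auto
      then show False using anti \<open>k \<noteq> l\<close> by (meson antisymD)
    qed
    moreover have "k \<notin> set ks" "l \<notin> set ls'" using Cons.prems ls by auto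
    ultimately have "set ks = set ls'" using Cons.prems(3) ls by auto
    then show ?case using Cons.IH[of ls'] Cons.prems ls \<open>k = l\<close> by simp
  qed
  show ?thesis using ex uniq by blast
qed

text \<open>
  The element \<open>s *\<^bsub>(\<Sigma>)\<^esub> a\<close>. Since \<^const>\<open>fold\<close> processes the list from the left, the
  substitution at the least index \<open>\<kappa>\<^sub>0\<close> is performed first, i.e. innermost.
\<close>

definition sub_fin ::
    "'k rel \<Rightarrow> ('a, 'k, 'm) subst_alg_scheme \<Rightarrow> ('k \<Rightarrow> 'a) \<Rightarrow> 'k set \<Rightarrow> 'a \<Rightarrow> 'a" where
  "sub_fin \<alpha> \<AA> s \<Sigma> a = fold (\<lambda>\<kappa>. sub \<AA> \<kappa> (s \<kappa>)) (increasing_enum \<alpha> \<Sigma>) a"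

definition strongly_distinguished :: "'k rel \<Rightarrow> ('a, 'k, 'm) subst_alg_scheme \<Rightarrow> bool" where
  "strongly_distinguished \<alpha> \<AA> \<longleftrightarrow>
    (\<forall>a\<in>carrier \<AA>. \<forall>b\<in>carrier \<AA>.
      (\<forall>s \<in> Field \<alpha> \<rightarrow>\<^sub>E zero_dim \<alpha> \<AA>.
        \<exists>\<Sigma>. finite \<Sigma> \<and> \<Sigma> \<subseteq> Field \<alpha> \<and> sub_fin \<alpha> \<AA> s \<Sigma> a = sub_fin \<alpha> \<AA> s \<Sigma> b)
      \<longrightarrow> a = b)"

text \<open>
  A family \<open>\<F>\<close> of subsets of \<open>I\<close> is represented by the filter for which
  \<open>eventually P \<F>\<close> means \<open>{i \<in> I. P i} \<in> \<F>\<close>; the filter lives on \<open>I\<close> when it is below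
  \<^term>\<open>principal I\<close>.
\<close>

definition ultrafilter_on :: "'i set \<Rightarrow> 'i filter \<Rightarrow> bool" where
  "ultrafilter_on I \<F> \<longleftrightarrow>
    \<F> \<le> principal I \<and> \<F> \<noteq> bot \<and> (\<forall>P. eventually P \<F> \<or> eventually (\<lambda>i. \<not> P i) \<F>)"

definition ultra_rel ::
    "'i set \<Rightarrow> 'i filter \<Rightarrow> ('i \<Rightarrow> ('a, 'k, 'm) subst_alg_scheme) \<Rightarrow> ('i \<Rightarrow> 'a) rel" where
  "ultra_rel I \<F> \<AA> =
    {(f, g). f \<in> (\<Pi>\<^sub>E i\<in>I. carrier (\<AA> i)) \<and> g \<in> (\<Pi>\<^sub>E i\<in>I. carrier (\<AA> i))
      \<and> eventually (\<lambda>i. f i = g i) \<F>}"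

text \<open>
  The operations are computed coordinatewise on representatives. All the classes in the union
  below coincide, as shown in \<open>sub_ultraproduct\<close>.
\<close>

definition ultraproduct ::
    "'i set \<Rightarrow> 'i filter \<Rightarrow> ('i \<Rightarrow> ('a, 'k, 'm) subst_alg_scheme) \<Rightarrow> (('i \<Rightarrow> 'a) set, 'k) subst_alg"
  where
  "ultraproduct I \<F> \<AA> =
    \<lparr>carrier = (\<Pi>\<^sub>E i\<in>I. carrier (\<AA> i)) // ultra_rel I \<F> \<AA>,
     sub = (\<lambda>\<kappa> X Y. \<Union>f\<in>X. \<Union>g\<in>Y. ultra_rel I \<F> \<AA> `` {\<lambda>i\<in>I. sub (\<AA> i) \<kappa> (f i) (g i)}),
     var = (\<lambda>\<kappa>. ultra_rel I \<F> \<AA> `` {\<lambda>i\<in>I. var (\<AA> i) \<kappa>})\<rparr>"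

lemma equiv_ultra_rel: "equiv (\<Pi>\<^sub>E i\<in>I. carrier (\<AA> i)) (ultra_rel I \<F> \<AA>)"
proof (rule equivI)
  show "trans (ultra_rel I \<F> \<AA>)"
  proof (rule transI)
    fix f g h assume fg: "(f, g) \<in> ultra_rel I \<F> \<AA>" and gh: "(g, h) \<in> ultra_rel I \<F> \<AA>"
    then have "eventually (\<lambda>i. f i = g i) \<F>" "eventually (\<lambda>i. g i = h i) \<F>"
      by (simp_all add: ultra_rel_def)
    then have "eventually (\<lambda>i. f i = h i) \<F>" by eventually_elim simp
    then show "(f, h) \<in> ultra_rel I \<F> \<AA>" using fg gh by (simp add: ultra_rel_def)
  qed
  show "sym (ultra_rel I \<F> \<AA>)"
    by (rule symI) (simp add: ultra_rel_def eq_commute)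
  show "refl_on (\<Pi>\<^sub>E i\<in>I. carrier (\<AA> i)) (ultra_rel I \<F> \<AA>)"
    by (rule refl_onI) (simp_all add: ultra_rel_def)
  show "ultra_rel I \<F> \<AA> \<subseteq> (\<Pi>\<^sub>E i\<in>I. carrier (\<AA> i)) \<times> (\<Pi>\<^sub>E i\<in>I. carrier (\<AA> i))"
    unfolding ultra_rel_def by blast
qed

lemma sub_ultraproduct:
  assumes "\<F> \<le> principal I"
    and "\<And>i. i \<in> I \<Longrightarrow> substitution_algebra \<alpha> (\<AA> i)"
    and "\<kappa> \<in> Field \<alpha>"
    and f: "f \<in> (\<Pi>\<^sub>E i\<in>I. carrier (\<AA> i))" and g: "g \<in> (\<Pi>\<^sub>E i\<in>I. carrier (\<AA> i))"
  shows "sub (ultraproduct I \<F> \<AA>) \<kappa> (ultra_rel I \<F> \<AA> `` {f}) (ultra_rel I \<F> \<AA> `` {g})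
    = ultra_rel I \<F> \<AA> `` {\<lambda>i\<in>I. sub (\<AA> i) \<kappa> (f i) (g i)}"
proof -
  let ?A = "\<Pi>\<^sub>E i\<in>I. carrier (\<AA> i)" and ?r = "ultra_rel I \<F> \<AA>"
  let ?op = "\<lambda>f g. \<lambda>i\<in>I. sub (\<AA> i) \<kappa> (f i) (g i)"
  have closed: "?op f g \<in> ?A" if "f \<in> ?A" "g \<in> ?A" for f g
    using that assms(2,3) by (auto intro!: substitution_algebra.sub_closed)
  have "congruent2 ?r ?r (\<lambda>f g. ?r `` {?op f g})"
  proof (rule congruent2I')
    fix f f' g g' assume r: "(f, f') \<in> ?r" "(g, g') \<in> ?r"
    then have A: "f \<in> ?A" "f' \<in> ?A" "g \<in> ?A" "g' \<in> ?A" by (auto simp: ultra_rel_def)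
    have "eventually (\<lambda>i. f i = f' i) \<F>" "eventually (\<lambda>i. g i = g' i) \<F>"
      using r by (auto simp: ultra_rel_def)
    then have "eventually (\<lambda>i. ?op f g i = ?op f' g' i) \<F>"
      by eventually_elim (auto simp: restrict_def)
    then have "(?op f g, ?op f' g') \<in> ?r"
      using closed[OF A(1,3)] closed[OF A(2,4)] unfolding ultra_rel_def by blast
    then show "?r `` {?op f g} = ?r `` {?op f' g'}"
      by (rule equiv_class_eq[OF equiv_ultra_rel])
  qed
  from UN_equiv_class2[OF equiv_ultra_rel equiv_ultra_rel this f g]
  show ?thesis by (simp add: ultraproduct_def)
qed

end

theory Submission
  imports Defs
begin

text \<open>
  If \<open>f / \<F> \<noteq> g / \<F>\<close>, then almost every \<open>\<AA>\<^sub>i\<close> has a sequence of zero-dimensional elements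
  that separates \<open>f i\<close> from \<open>g i\<close> under all finite substitutions at once. The classes of these
  sequences are zero-dimensional in the ultraproduct. A single finite \<open>\<Sigma>\<close> identifying the two
  classes would, since finite substitutions are computed coordinatewise, identify almost all
  coordinates under \<open>\<Sigma>\<close>.
\<close>

lemma set_increasing_enum:
  assumes "Well_order \<alpha>" and "finite \<Sigma>" and "\<Sigma> \<subseteq> Field \<alpha>"
  shows "set (increasing_enum \<alpha> \<Sigma>) = \<Sigma>"
  using theI'[OF increasing_enum_ex1[OF assms]] by (simp add: increasing_enum_def)

lemma zero_dim_iff:
  "x \<in> zero_dim \<alpha> \<AA> \<longleftrightarrow>
    x \<in> carrier \<AA> \<and> (\<forall>\<kappa>\<in>Field \<alpha>. \<forall>a\<in>carrier \<AA>. sub \<AA> \<kappa> a x = x)"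
  by (auto simp: zero_dim_def dim_set_def)

lemma carrier_ultraproduct:
  "carrier (ultraproduct I \<F> \<AA>) = (\<Pi>\<^sub>E i\<in>I. carrier (\<AA> i)) // ultra_rel I \<F> \<AA>"
  by (simp add: ultraproduct_def)

lemma ultra_class_eq_iff:
  assumes "f \<in> (\<Pi>\<^sub>E i\<in>I. carrier (\<AA> i))" and "g \<in> (\<Pi>\<^sub>E i\<in>I. carrier (\<AA> i))"
  shows "ultra_rel I \<F> \<AA> `` {f} = ultra_rel I \<F> \<AA> `` {g} \<longleftrightarrow>
    eventually (\<lambda>i. f i = g i) \<F>"
  using eq_equiv_class_iff[OF equiv_ultra_rel assms] assms by (simp add: ultra_rel_def)

lemma fold_sub_closed:
  assumes "substitution_algebra \<alpha> \<AA>" and "set ks \<subseteq> Field \<alpha>"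
    and "\<And>\<kappa>. \<kappa> \<in> Field \<alpha> \<Longrightarrow> s \<kappa> \<in> carrier \<AA>" and "a \<in> carrier \<AA>"
  shows "fold (\<lambda>\<kappa>. sub \<AA> \<kappa> (s \<kappa>)) ks a \<in> carrier \<AA>"
  using assms(2,4)
  by (induction ks arbitrary: a) (auto intro: substitution_algebra.sub_closed[OF assms(1)] assms(3))

text \<open>Each substitution moves the class of a representative to the class of its coordinatewise
  substitution, by \<open>sub_ultraproduct\<close>, so induction on the list composes these moves.
  One list serves all coordinates because the algebras share \<alpha>. An arbitrary list replaces
  \<open>increasing_enum\<close> so that the induction goes through.\<close>

lemma fold_sub_ultraproduct:
  assumes "\<F> \<le> principal I"
    and alg: "\<And>i. i \<in> I \<Longrightarrow> substitution_algebra \<alpha> (\<AA> i)"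
    and "set ks \<subseteq> Field \<alpha>"
    and t: "\<And>\<kappa>. \<kappa> \<in> Field \<alpha> \<Longrightarrow> t \<kappa> \<in> (\<Pi>\<^sub>E i\<in>I. carrier (\<AA> i))"
    and s: "\<And>\<kappa>. \<kappa> \<in> Field \<alpha> \<Longrightarrow> s \<kappa> = ultra_rel I \<F> \<AA> `` {t \<kappa>}"
    and "f \<in> (\<Pi>\<^sub>E i\<in>I. carrier (\<AA> i))"
  shows "fold (\<lambda>\<kappa>. sub (ultraproduct I \<F> \<AA>) \<kappa> (s \<kappa>)) ks (ultra_rel I \<F> \<AA> `` {f})
    = ultra_rel I \<F> \<AA> `` {\<lambda>i\<in>I. fold (\<lambda>\<kappa>. sub (\<AA> i) \<kappa> (t \<kappa> i)) ks (f i)}"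
  using assms(3,6)
proof (induction ks arbitrary: f)
  case Nil
  then have "(\<lambda>i\<in>I. f i) = f" by (auto simp: PiE_def extensional_restrict)
  then show ?case by simp
next
  case (Cons \<kappa> ks)
  let ?h = "\<lambda>i\<in>I. sub (\<AA> i) \<kappa> (t \<kappa> i) (f i)"
  have \<kappa>: "\<kappa> \<in> Field \<alpha>" using Cons.prems by simp
  have h: "?h \<in> (\<Pi>\<^sub>E i\<in>I. carrier (\<AA> i))"
    using t[OF \<kappa>] Cons.prems \<kappa> by (auto intro!: substitution_algebra.sub_closed[OF alg])
  have "fold (\<lambda>\<kappa>. sub (ultraproduct I \<F> \<AA>) \<kappa> (s \<kappa>)) (\<kappa> # ks) (ultra_rel I \<F> \<AA> `` {f})
      = fold (\<lambda>\<kappa>. sub (ultraproduct I \<F> \<AA>) \<kappa> (s \<kappa>)) ks (ultra_rel I \<F> \<AA> `` {?h})"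
    using sub_ultraproduct[OF assms(1) alg \<kappa> t[OF \<kappa>] Cons.prems(2)] s[OF \<kappa>] by simp
  also have "\<dots> = ultra_rel I \<F> \<AA> `` {\<lambda>i\<in>I. fold (\<lambda>\<kappa>. sub (\<AA> i) \<kappa> (t \<kappa> i)) ks (?h i)}"
    using Cons.prems by (intro Cons.IH[OF _ h]) simp
  also have "(\<lambda>i\<in>I. fold (\<lambda>\<kappa>. sub (\<AA> i) \<kappa> (t \<kappa> i)) ks (?h i))
      = (\<lambda>i\<in>I. fold (\<lambda>\<kappa>. sub (\<AA> i) \<kappa> (t \<kappa> i)) (\<kappa> # ks) (f i))"
    by (rule restrict_ext) simp
  finally show ?case .
qed

text \<open>Substituting the class of \<open>h\<close> into that of \<open>f\<close> gives the class
  of \<open>?p\<close>, and \<open>?p\<close> agrees with \<open>f\<close> wherever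
  \<open>f i\<close> is zero-dimensional. Asking this only almost everywhere allows arbitrary filler
  values on a negligible set of coordinates.\<close>

lemma ultra_class_zero_dim:
  assumes "\<F> \<le> principal I"
    and alg: "\<And>i. i \<in> I \<Longrightarrow> substitution_algebra \<alpha> (\<AA> i)"
    and f: "f \<in> (\<Pi>\<^sub>E i\<in>I. carrier (\<AA> i))"
    and zero: "eventually (\<lambda>i. f i \<in> zero_dim \<alpha> (\<AA> i)) \<F>"
  shows "ultra_rel I \<F> \<AA> `` {f} \<in> zero_dim \<alpha> (ultraproduct I \<F> \<AA>)"
  unfolding zero_dim_iff carrier_ultraproduct
proof (intro conjI ballI)
  show "ultra_rel I \<F> \<AA> `` {f} \<in> (\<Pi>\<^sub>E i\<in>I. carrier (\<AA> i)) // ultra_rel I \<F> \<AA>"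
    using f by (rule quotientI)
next
  fix \<kappa> X
  assume \<kappa>: "\<kappa> \<in> Field \<alpha>" and "X \<in> (\<Pi>\<^sub>E i\<in>I. carrier (\<AA> i)) // ultra_rel I \<F> \<AA>"
  then obtain h where h: "h \<in> (\<Pi>\<^sub>E i\<in>I. carrier (\<AA> i))" and X: "X = ultra_rel I \<F> \<AA> `` {h}"
    by (auto elim: quotientE)
  let ?p = "\<lambda>i\<in>I. sub (\<AA> i) \<kappa> (h i) (f i)"
  have p: "?p \<in> (\<Pi>\<^sub>E i\<in>I. carrier (\<AA> i))"
    using h f \<kappa> by (auto intro!: substitution_algebra.sub_closed[OF alg])
  have "eventually (\<lambda>i. i \<in> I) \<F>"
    using assms(1) by (simp add: le_principal)
  with zero have "eventually (\<lambda>i. ?p i = f i) \<F>"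
    by eventually_elim (use h \<kappa> in \<open>auto simp: zero_dim_iff\<close>)
  then show "sub (ultraproduct I \<F> \<AA>) \<kappa> X (ultra_rel I \<F> \<AA> `` {f}) = ultra_rel I \<F> \<AA> `` {f}"
    using sub_ultraproduct[OF assms(1) alg \<kappa> h f] ultra_class_eq_iff[OF p f] by (simp add: X)
qed

theorem theorem3p5:
  fixes \<alpha> :: "'k rel"
    and I :: "'i set"
    and \<F> :: "'i filter"
    and \<AA> :: "'i \<Rightarrow> ('a, 'k) subst_alg"
  assumes "Well_order \<alpha>"
    and "ultrafilter_on I \<F>"
    and "\<And>i. i \<in> I \<Longrightarrow> substitution_algebra \<alpha> (\<AA> i)"
    and "\<And>i. i \<in> I \<Longrightarrow> strongly_distinguished \<alpha> (\<AA> i)"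
  shows "strongly_distinguished \<alpha> (ultraproduct I \<F> \<AA>)"
  unfolding strongly_distinguished_def
proof (intro ballI impI, rule ccontr)
  let ?A = "\<Pi>\<^sub>E i\<in>I. carrier (\<AA> i)" and ?U = "ultraproduct I \<F> \<AA>"
  let ?cls = "\<lambda>f. ultra_rel I \<F> \<AA> `` {f}"
  have le: "\<F> \<le> principal I" and nontriv: "\<F> \<noteq> bot"
    and ultra: "\<And>P. eventually P \<F> \<or> eventually (\<lambda>i. \<not> P i) \<F>"
    using assms(2) by (auto simp: ultrafilter_on_def)
  have ev_I: "eventually (\<lambda>i. i \<in> I) \<F>" using le by (simp add: le_principal)
  fix a b
  assume "a \<in> carrier ?U" "b \<in> carrier ?U" and neq: "a \<noteq> b"
    and agree: "\<forall>s\<in>Field \<alpha> \<rightarrow>\<^sub>E zero_dim \<alpha> ?U.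
      \<exists>\<Sigma>. finite \<Sigma> \<and> \<Sigma> \<subseteq> Field \<alpha> \<and> sub_fin \<alpha> ?U s \<Sigma> a = sub_fin \<alpha> ?U s \<Sigma> b"
  then obtain f g where f: "f \<in> ?A" "a = ?cls f" and g: "g \<in> ?A" "b = ?cls g"
    unfolding carrier_ultraproduct by (auto elim!: quotientE)
  \<comment> \<open>Maximality of the ultrafilter turns failure of almost-everywhere equality into
    almost-everywhere inequality.\<close>
  have ev_neq: "eventually (\<lambda>i. f i \<noteq> g i) \<F>"
    using neq f g ultra[of "\<lambda>i. f i = g i"] ultra_class_eq_iff[OF f(1) g(1)] by auto
  \<comment> \<open>Contrapositive of strong distinction in one factor. The sequence is fixed before
    \<Sigma>, so it defeats every finite \<Sigma>, including the one supplied later by the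
    ultraproduct.\<close>
  have "\<exists>s. s \<in> Field \<alpha> \<rightarrow>\<^sub>E zero_dim \<alpha> (\<AA> i) \<and>
      (\<forall>\<Sigma>. finite \<Sigma> \<longrightarrow> \<Sigma> \<subseteq> Field \<alpha> \<longrightarrow> sub_fin \<alpha> (\<AA> i) s \<Sigma> (f i) \<noteq> sub_fin \<alpha> (\<AA> i) s \<Sigma> (g i))"
    if "i \<in> I" "f i \<noteq> g i" for i
  proof (rule ccontr)
    assume "\<not> ?thesis"
    then have "\<forall>s\<in>Field \<alpha> \<rightarrow>\<^sub>E zero_dim \<alpha> (\<AA> i).
        \<exists>\<Sigma>. finite \<Sigma> \<and> \<Sigma> \<subseteq> Field \<alpha> \<and> sub_fin \<alpha> (\<AA> i) s \<Sigma> (f i) = sub_fin \<alpha> (\<AA> i) s \<Sigma> (g i)"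
      by meson
    moreover have "f i \<in> carrier (\<AA> i)" "g i \<in> carrier (\<AA> i)"
      using f(1) g(1) that(1) by (auto dest: PiE_mem)
    ultimately have "f i = g i"
      using assms(4)[OF that(1), unfolded strongly_distinguished_def] by simp
    with that(2) show False ..
  qed
  then obtain S where S: "\<And>i. i \<in> I \<Longrightarrow> f i \<noteq> g i \<Longrightarrow> S i \<in> Field \<alpha> \<rightarrow>\<^sub>E zero_dim \<alpha> (\<AA> i)"
    and sep: "\<And>i \<Sigma>. i \<in> I \<Longrightarrow> f i \<noteq> g i \<Longrightarrow> finite \<Sigma> \<Longrightarrow> \<Sigma> \<subseteq> Field \<alpha> \<Longrightarrow>
      sub_fin \<alpha> (\<AA> i) (S i) \<Sigma> (f i) \<noteq> sub_fin \<alpha> (\<AA> i) (S i) \<Sigma> (g i)"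
    by moura
  \<comment> \<open>The separating sequences are transposed: \<open>t \<kappa>\<close> collects
    their entries at \<kappa> over all coordinates. Where \<open>f i = g i\<close> there is nothing
    to separate, and \<open>f i\<close> serves as a filler that keeps \<open>t \<kappa>\<close> in
    the product.\<close>
  define t where "t \<kappa> = (\<lambda>i\<in>I. if f i \<noteq> g i then S i \<kappa> else f i)" for \<kappa>
  define s where "s = (\<lambda>\<kappa>\<in>Field \<alpha>. ?cls (t \<kappa>))"
  have t: "t \<kappa> \<in> ?A" if "\<kappa> \<in> Field \<alpha>" for \<kappa>
  proof -
    have "S i \<kappa> \<in> carrier (\<AA> i)" if "i \<in> I" "f i \<noteq> g i" for i
      using PiE_mem[OF S[OF that] \<open>\<kappa> \<in> Field \<alpha>\<close>] by (simp add: zero_dim_iff)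
    then show ?thesis using f(1) g(1) by (auto simp: t_def)
  qed
  have "?cls (t \<kappa>) \<in> zero_dim \<alpha> ?U" if \<kappa>: "\<kappa> \<in> Field \<alpha>" for \<kappa>
  proof -
    have "eventually (\<lambda>i. t \<kappa> i \<in> zero_dim \<alpha> (\<AA> i)) \<F>"
      using ev_I ev_neq by eventually_elim (simp add: t_def PiE_mem[OF S \<kappa>])
    then show ?thesis by (simp add: ultra_class_zero_dim[OF le assms(3) t[OF \<kappa>]])
  qed
  then have "s \<in> Field \<alpha> \<rightarrow>\<^sub>E zero_dim \<alpha> ?U" by (auto simp: s_def)
  from bspec[OF agree this] obtain \<Sigma> where fin: "finite \<Sigma>" and sub: "\<Sigma> \<subseteq> Field \<alpha>"
    and eq: "sub_fin \<alpha> ?U s \<Sigma> a = sub_fin \<alpha> ?U s \<Sigma> b"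
    by (elim exE conjE)
  have ks: "set (increasing_enum \<alpha> \<Sigma>) \<subseteq> Field \<alpha>"
    using set_increasing_enum[OF assms(1) fin sub] sub by simp
  \<comment> \<open>The same \<Sigma> is applied in every coordinate, so \<open>?c h\<close>
    represents the result of substituting in the class of \<open>h\<close>.\<close>
  let ?c = "\<lambda>h. \<lambda>i\<in>I. sub_fin \<alpha> (\<AA> i) (\<lambda>\<kappa>. t \<kappa> i) \<Sigma> (h i)"
  have c: "?c h \<in> ?A" if "h \<in> ?A" for h
    unfolding sub_fin_def using that
    by (intro restrict_PiE_iff[THEN iffD2] ballI fold_sub_closed[OF assms(3) ks] PiE_mem[OF t])
      (auto dest: PiE_mem)
  have sub_cls: "sub_fin \<alpha> ?U s \<Sigma> (?cls h) = ?cls (?c h)" if "h \<in> ?A" for h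
    unfolding sub_fin_def
    by (rule fold_sub_ultraproduct[OF le assms(3) ks t _ that]) (simp_all add: s_def)
  have "eventually (\<lambda>i. ?c f i = ?c g i) \<F>"
    using eq ultra_class_eq_iff[OF c[OF f(1)] c[OF g(1)], of \<F>]
      sub_cls[OF f(1)] sub_cls[OF g(1)] by (simp only: f(2) g(2))
  then have "eventually (\<lambda>i. False) \<F>"
    using ev_I ev_neq
  proof eventually_elim
    case (elim i)
    \<comment> \<open>At a coordinate in \<open>I\<close> with \<open>f i \<noteq> g i\<close>, the
      section of \<open>t\<close> at \<open>i\<close> is the whole function \<open>S i\<close>, so
      \<open>sep\<close> contradicts the equality of \<open>?c f\<close> and \<open>?c g\<close>
      there.\<close>
    have "sub_fin \<alpha> (\<AA> i) (\<lambda>\<kappa>. t \<kappa> i) \<Sigma> x = sub_fin \<alpha> (\<AA> i) (S i) \<Sigma> x" for x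
      using elim by (simp add: t_def)
    then show False using elim sep[OF elim(2,3) fin sub] by simp
  qed
  with nontriv show False by (simp add: eventually_False)
qed

end
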